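(* For any frame $L$, the map $\mathsf{pt}:\mathsf{sp}[\mathsf{S}(L)]\to\mathsf{sob}[\mathcal{P}(\mathsf{pt}(L))]$, $S\mapsto\mathsf{pt}(S)=\mathsf{pt}(L)\cap S$, is an isomorphism of coframes. Its inverse acts as $Y\mapsto\mathfrak{M}(Y)$.
   Context: For a frame $L$, a prime is an element $p\neq 1$ such that $x\wedge y\leq p$ implies $x\leq p$ or $y\leq p$. $\mathsf{pt}(L)$ is the set of primes of $L$, topologized with open sets $\{p\in\mathsf{pt}(L): a\nleq p\}$, $a\in L$. A sublocale of $L$ is a subset $S\subseteq L$ closed under arbitrary meets (so $1\in S$) such that $s\in S$ implies $x\to s\in S$ for all $x\in L$; it is itself a frame in the inherited order. $\mathsf{S}(L)$ is the coframe of all sublocales ordered by inclusion. For a sublocale $S$, the primes of the frame $S$ are exactly the elements of $\mathsf{pt}(S)=\mathsf{pt}(L)\cap S$. A frame is spatial if every element is a meet of primes; $\mathsf{sp}[\mathsf{S}(L)]$ is the collection of spatial sublocales of $L$ ordered by inclusion. A space is sober if every irreducible closed set is the closure of a unique point; $\mathsf{sob}[\mathcal{P}(\mathsf{pt}(L))]$ is the collection of sober subspaces of $\mathsf{pt}(L)$ ordered by inclusion. For $Y\subseteq\mathsf{pt}(L)$, $\mathfrak{M}(Y)=\{\bigwedge M: M\subseteq Y\}$ (meets in $L$, including the empty meet $1$). *)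

theory Defs
  imports "HOL-Algebra.Complete_Lattice" "HOL-Analysis.Abstract_Topology"
begin

section \<open>Frames and coframes\<close>

text \<open>
  Orders are HOL-Algebra orders with an explicit carrier, so that a sublocale \<open>S\<close> of \<open>L\<close>, with the
  inherited order, is the structure \<open>L\<lparr>carrier := S\<rparr>\<close>, and collections of sets ordered by inclusion
  are structures of the same kind.
\<close>

locale frame = complete_lattice L for L (structure) +
  assumes meet_sup_distrib:
    "\<lbrakk>x \<in> carrier L; A \<subseteq> carrier L\<rbrakk> \<Longrightarrow> x \<sqinter> \<Squnion>A = \<Squnion>((\<lambda>a. x \<sqinter> a) ` A)"

locale coframe = complete_lattice L for L (structure) +
  assumes join_inf_distrib:
    "\<lbrakk>x \<in> carrier L; A \<subseteq> carrier L\<rbrakk> \<Longrightarrow> x \<squnion> \<Sqinter>A = \<Sqinter>((\<lambda>a. x \<squnion> a) ` A)"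

text \<open>Coframe morphisms preserve arbitrary meets and finite (including empty) joins.\<close>

definition coframe_hom ::
    "('a, 'c) gorder_scheme \<Rightarrow> ('b, 'd) gorder_scheme \<Rightarrow> ('a \<Rightarrow> 'b) \<Rightarrow> bool" where
  "coframe_hom A B f \<longleftrightarrow>
     coframe A \<and> coframe B \<and> f \<in> carrier A \<rightarrow> carrier B \<and>
     (\<forall>X \<subseteq> carrier A. f (\<Sqinter>\<^bsub>A\<^esub>X) = \<Sqinter>\<^bsub>B\<^esub>(f ` X)) \<and>
     (\<forall>x \<in> carrier A. \<forall>y \<in> carrier A. f (x \<squnion>\<^bsub>A\<^esub> y) = f x \<squnion>\<^bsub>B\<^esub> f y) \<and>
     f \<bottom>\<^bsub>A\<^esub> = \<bottom>\<^bsub>B\<^esub>"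

definition coframe_iso ::
    "('a, 'c) gorder_scheme \<Rightarrow> ('b, 'd) gorder_scheme \<Rightarrow> ('a \<Rightarrow> 'b) \<Rightarrow> bool" where
  "coframe_iso A B f \<longleftrightarrow>
     coframe_hom A B f \<and>
     (\<exists>g. coframe_hom B A g \<and>
          (\<forall>x \<in> carrier A. g (f x) = x) \<and> (\<forall>y \<in> carrier B. f (g y) = y))"

definition inclusion_order :: "'a set set \<Rightarrow> 'a set gorder" where
  "inclusion_order \<A> = \<lparr>carrier = \<A>, eq = (=), le = (\<subseteq>)\<rparr>"


section \<open>Primes, spatiality, sublocales\<close>

definition pt :: "('a, 'm) gorder_scheme \<Rightarrow> 'a set" where
  "pt L = {p \<in> carrier L. p \<noteq> \<top>\<^bsub>L\<^esub> \<and>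
     (\<forall>x \<in> carrier L. \<forall>y \<in> carrier L. x \<sqinter>\<^bsub>L\<^esub> y \<sqsubseteq>\<^bsub>L\<^esub> p \<longrightarrow> x \<sqsubseteq>\<^bsub>L\<^esub> p \<or> y \<sqsubseteq>\<^bsub>L\<^esub> p)}"

definition spatial :: "('a, 'm) gorder_scheme \<Rightarrow> bool" where
  "spatial L \<longleftrightarrow> (\<forall>a \<in> carrier L. \<exists>P \<subseteq> pt L. a = \<Sqinter>\<^bsub>L\<^esub>P)"

definition himp :: "('a, 'm) gorder_scheme \<Rightarrow> 'a \<Rightarrow> 'a \<Rightarrow> 'a" where
  "himp L x y = \<Squnion>\<^bsub>L\<^esub>{z \<in> carrier L. z \<sqinter>\<^bsub>L\<^esub> x \<sqsubseteq>\<^bsub>L\<^esub> y}"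

definition is_sublocale :: "('a, 'm) gorder_scheme \<Rightarrow> 'a set \<Rightarrow> bool" where
  "is_sublocale L S \<longleftrightarrow>
     S \<subseteq> carrier L \<and>
     (\<forall>A \<subseteq> S. \<Sqinter>\<^bsub>L\<^esub>A \<in> S) \<and>
     (\<forall>x \<in> carrier L. \<forall>s \<in> S. himp L x s \<in> S)"

abbreviation sub_order :: "('a, 'm) gorder_scheme \<Rightarrow> 'a set \<Rightarrow> ('a, 'm) gorder_scheme" where
  "sub_order L S \<equiv> L\<lparr>carrier := S\<rparr>"

definition spatial_sublocales :: "('a, 'm) gorder_scheme \<Rightarrow> 'a set gorder" where
  "spatial_sublocales L = inclusion_order {S. is_sublocale L S \<and> spatial (sub_order L S)}"

definition meets_of :: "('a, 'm) gorder_scheme \<Rightarrow> 'a set \<Rightarrow> 'a set" where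
  "meets_of L Y = {\<Sqinter>\<^bsub>L\<^esub>M | M. M \<subseteq> Y}"


section \<open>The spectrum and sober subspaces\<close>

definition pt_space :: "('a, 'm) gorder_scheme \<Rightarrow> 'a topology" where
  "pt_space L = topology (\<lambda>U. \<exists>a \<in> carrier L. U = {p \<in> pt L. \<not> a \<sqsubseteq>\<^bsub>L\<^esub> p})"

text \<open>Irreducible sets are nonempty by convention; otherwise no space would be sober.\<close>

definition irreducible_closed :: "'a topology \<Rightarrow> 'a set \<Rightarrow> bool" where
  "irreducible_closed X C \<longleftrightarrow>
     closedin X C \<and> C \<noteq> {} \<and>
     (\<forall>A B. closedin X A \<and> closedin X B \<and> C = A \<union> B \<longrightarrow> C = A \<or> C = B)"

definition sober_space :: "'a topology \<Rightarrow> bool" where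
  "sober_space X \<longleftrightarrow>
     (\<forall>C. irreducible_closed X C \<longrightarrow> (\<exists>!x. x \<in> topspace X \<and> C = X closure_of {x}))"

definition sober_subspaces :: "('a, 'm) gorder_scheme \<Rightarrow> 'a set gorder" where
  "sober_subspaces L =
     inclusion_order {Y. Y \<subseteq> pt L \<and> sober_space (subtopology (pt_space L) Y)}"


text \<open>The sets in the definition of \<^const>\<open>pt_space\<close> do form a topology on \<^term>\<open>pt L\<close>.\<close>

lemma openin_pt_space:
  assumes "frame L"
  shows "openin (pt_space L) U \<longleftrightarrow> (\<exists>a \<in> carrier L. U = {p \<in> pt L. \<not> a \<sqsubseteq>\<^bsub>L\<^esub> p})"
proof -
  interpret frame L by fact
  let ?O = "\<lambda>a. {p \<in> pt L. \<not> a \<sqsubseteq>\<^bsub>L\<^esub> p}"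
  have carr: "p \<in> carrier L" if "p \<in> pt L" for p
    using that by (simp add: pt_def)
  have int: "?O a \<inter> ?O b = ?O (a \<sqinter>\<^bsub>L\<^esub> b)" if ab: "a \<in> carrier L" "b \<in> carrier L" for a b
  proof -
    have "a \<sqinter>\<^bsub>L\<^esub> b \<sqsubseteq>\<^bsub>L\<^esub> p \<longleftrightarrow> a \<sqsubseteq>\<^bsub>L\<^esub> p \<or> b \<sqsubseteq>\<^bsub>L\<^esub> p" if p: "p \<in> pt L" for p
    proof
      show "a \<sqinter>\<^bsub>L\<^esub> b \<sqsubseteq>\<^bsub>L\<^esub> p \<Longrightarrow> a \<sqsubseteq>\<^bsub>L\<^esub> p \<or> b \<sqsubseteq>\<^bsub>L\<^esub> p"
        using p ab by (simp add: pt_def)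
      show "a \<sqsubseteq>\<^bsub>L\<^esub> p \<or> b \<sqsubseteq>\<^bsub>L\<^esub> p \<Longrightarrow> a \<sqinter>\<^bsub>L\<^esub> b \<sqsubseteq>\<^bsub>L\<^esub> p"
        using le_trans[OF meet_left[OF ab] _ meet_closed[OF ab] ab(1) carr[OF p]]
          le_trans[OF meet_right[OF ab] _ meet_closed[OF ab] ab(2) carr[OF p]] by argo
    qed
    then show ?thesis by auto
  qed
  have un: "(\<Union>a\<in>A. ?O a) = ?O (\<Squnion>\<^bsub>L\<^esub>A)" if A: "A \<subseteq> carrier L" for A
  proof -
    have "\<Squnion>\<^bsub>L\<^esub>A \<sqsubseteq>\<^bsub>L\<^esub> p \<longleftrightarrow> (\<forall>a\<in>A. a \<sqsubseteq>\<^bsub>L\<^esub> p)" if p: "p \<in> pt L" for p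
    proof
      show "\<forall>a\<in>A. a \<sqsubseteq>\<^bsub>L\<^esub> p" if "\<Squnion>\<^bsub>L\<^esub>A \<sqsubseteq>\<^bsub>L\<^esub> p"
      proof
        fix a assume "a \<in> A"
        then show "a \<sqsubseteq>\<^bsub>L\<^esub> p"
          using le_trans[OF weak.sup_upper[OF A] that _ weak.sup_closed[OF A] carr[OF p]] A by auto
      qed
      show "\<Squnion>\<^bsub>L\<^esub>A \<sqsubseteq>\<^bsub>L\<^esub> p" if "\<forall>a\<in>A. a \<sqsubseteq>\<^bsub>L\<^esub> p"
        using that by (intro weak.sup_least A carr[OF p]) auto
    qed
    then show ?thesis by auto
  qed
  have "istopology (\<lambda>U. \<exists>a \<in> carrier L. U = ?O a)"
    unfolding istopology_def
  proof (intro conjI allI impI)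
    fix S T
    assume "\<exists>a\<in>carrier L. S = ?O a" "\<exists>a\<in>carrier L. T = ?O a"
    then obtain a b where ab: "a \<in> carrier L" "b \<in> carrier L" "S = ?O a" "T = ?O b"
      by blast
    then have "S \<inter> T = ?O (a \<sqinter>\<^bsub>L\<^esub> b)" using int[of a b] by simp
    then show "\<exists>a\<in>carrier L. S \<inter> T = ?O a"
      using meet_closed[OF ab(1,2)] by (rule bexI)
  next
    fix \<K>
    assume K: "\<forall>K\<in>\<K>. \<exists>a\<in>carrier L. K = ?O a"
    let ?A = "{a \<in> carrier L. ?O a \<in> \<K>}"
    have "\<K> = ?O ` ?A"
    proof (intro Set.set_eqI iffI)
      fix U assume U: "U \<in> \<K>"
      with K obtain a where "a \<in> carrier L" "U = ?O a" by meson
      with U show "U \<in> ?O ` ?A" by (intro image_eqI[of _ _ a]) simp_all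
    next
      fix U assume "U \<in> ?O ` ?A"
      then show "U \<in> \<K>" by (elim imageE) simp
    qed
    then have "\<Union>\<K> = (\<Union>a\<in>?A. ?O a)" by (rule arg_cong)
    also have "\<dots> = ?O (\<Squnion>\<^bsub>L\<^esub>?A)" by (rule un) auto
    finally show "\<exists>a\<in>carrier L. \<Union>\<K> = ?O a"
      by (rule bexI) (rule weak.sup_closed, auto)
  qed
  then show ?thesis
    by (simp only: pt_space_def topology_inverse')
qed

lemma topspace_pt_space:
  assumes "frame L"
  shows "topspace (pt_space L) = pt L"
proof -
  interpret frame L by fact
  have "\<not> \<top>\<^bsub>L\<^esub> \<sqsubseteq>\<^bsub>L\<^esub> p" if "p \<in> pt L" for p
    using that le_antisym[of p "\<top>\<^bsub>L\<^esub>"] top_higher[of p] by (auto simp: pt_def)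
  then have "{p \<in> pt L. \<not> \<top>\<^bsub>L\<^esub> \<sqsubseteq>\<^bsub>L\<^esub> p} = pt L"
    by blast
  then have "openin (pt_space L) (pt L)"
    unfolding openin_pt_space[OF assms] using top_closed by (intro bexI[of _ "\<top>\<^bsub>L\<^esub>"]) simp_all
  moreover have "topspace (pt_space L) \<subseteq> pt L"
    using openin_topspace[of "pt_space L"] unfolding openin_pt_space[OF assms]
    by (elim bexE) simp
  ultimately show ?thesis
    by (meson openin_subset subset_antisym)
qed

end

theory Submission
  imports Defs
begin

text \<open>
  Everything rests on the operator \<open>j Y = pt L \<inter> \<M> Y\<close> on sets \<open>Y\<close> of primes, where \<open>\<M> Y\<close>
  is the set of meets of subsets of \<open>Y\<close>.

  On the localic side, a sublocale \<open>S\<close> has \<open>pt L \<inter> S\<close> as its set of primes, so spatiality of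
  \<open>S\<close> says exactly \<open>S = \<M> (pt L \<inter> S)\<close>. Conversely \<open>\<M> Y\<close> is always a spatial sublocale:
  for a prime \<open>p\<close> the element \<open>x \<rightarrow> p\<close> is either \<open>p\<close> or the top, so \<open>x \<rightarrow> _\<close> merely deletes
  some primes from a meet of primes. Hence \<open>S \<mapsto> pt L \<inter> S\<close> and \<open>\<M>\<close> are mutually inverse
  between the spatial sublocales and the fixed points of \<open>j\<close>.

  On the spatial side, the irreducible closed sets of the subspace \<open>Y\<close> are the sets
  \<open>{q \<in> Y. p \<sqsubseteq> q}\<close> with \<open>p \<in> j Y\<close>: the meet of an irreducible closed set is a prime that
  determines it. Such a set is the closure of a point of \<open>Y\<close> only if that point is \<open>p\<close> itself.
  So \<open>Y\<close> is sober if and only if \<open>j Y = Y\<close> (lemma \<open>sober_pt_subspace_iff\<close>).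

  Both bijections are monotone, so what remains is that the fixed points of \<open>j\<close> form a coframe.
  They are closed under intersections since \<open>j\<close> is a closure operator, and under binary unions
  since a prime that is a binary meet equals one of the two factors (lemma \<open>pt_meets_of_Un\<close>).
  The coframe structure then passes along the order isomorphism (lemma \<open>coframe_iso_if_order_iso\<close>).
\<close>

section \<open>Order isomorphisms and coframes of sets\<close>

lemma complete_lattice_Inf_greatest:
  assumes "complete_lattice L" "A \<subseteq> carrier L"
  shows "greatest L (\<Sqinter>\<^bsub>L\<^esub>A) (Lower L A)"
proof -
  interpret complete_lattice L by fact
  show ?thesis
    using weak.inf_glb[OF assms(2)] .
qed

lemma complete_lattice_Sup_least:
  assumes "complete_lattice L" "A \<subseteq> carrier L"
  shows "least L (\<Squnion>\<^bsub>L\<^esub>A) (Upper L A)"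
proof -
  interpret complete_lattice L by fact
  show ?thesis
    using weak.sup_lub[OF assms(2)] .
qed

lemma Inf_eqI:
  assumes "partial_order L" "greatest L x (Lower L A)"
  shows "\<Sqinter>\<^bsub>L\<^esub>A = x"
  unfolding inf_def
  using assms(2) partial_order.greatest_unique[OF assms(1) _ assms(2)] by (rule some_equality)

lemma Sup_eqI:
  assumes "partial_order L" "least L x (Upper L A)"
  shows "\<Squnion>\<^bsub>L\<^esub>A = x"
  unfolding sup_def
  using assms(2) partial_order.least_unique[OF assms(1) _ assms(2)] by (rule some_equality)

lemma bottom_eqI:
  assumes "partial_order L" "least L x (carrier L)"
  shows "\<bottom>\<^bsub>L\<^esub> = x"
  unfolding bottom_def
  using assms(2) partial_order.least_unique[OF assms(1) _ assms(2)] by (rule some_equality)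

text \<open>
  Meets, joins and the least element are determined by the order alone, so an order isomorphism
  onto a coframe carries all of that structure, together with the distributive law, back to its
  source.
\<close>

lemma coframe_iso_if_order_iso:
  assumes A: "partial_order A" and B: "coframe B"
    and f: "f \<in> carrier A \<rightarrow> carrier B" and g: "g \<in> carrier B \<rightarrow> carrier A"
    and gf: "\<And>x. x \<in> carrier A \<Longrightarrow> g (f x) = x"
    and fg: "\<And>y. y \<in> carrier B \<Longrightarrow> f (g y) = y"
    and emb: "\<And>x y. \<lbrakk>x \<in> carrier A; y \<in> carrier A\<rbrakk> \<Longrightarrow> f x \<sqsubseteq>\<^bsub>B\<^esub> f y \<longleftrightarrow> x \<sqsubseteq>\<^bsub>A\<^esub> y"
  shows "coframe_iso A B f"
proof -
  interpret B: coframe B by fact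
  have fc: "f x \<in> carrier B" if "x \<in> carrier A" for x
    using that f by blast
  have gc: "g y \<in> carrier A" if "y \<in> carrier B" for y
    using that g by blast
  have emb1: "f x \<sqsubseteq>\<^bsub>B\<^esub> y \<longleftrightarrow> x \<sqsubseteq>\<^bsub>A\<^esub> g y" if "x \<in> carrier A" "y \<in> carrier B" for x y
    using emb[OF that(1) gc[OF that(2)]] fg[OF that(2)] by simp
  have emb2: "y \<sqsubseteq>\<^bsub>B\<^esub> f x \<longleftrightarrow> g y \<sqsubseteq>\<^bsub>A\<^esub> x" if "x \<in> carrier A" "y \<in> carrier B" for x y
    using emb[OF gc[OF that(2)] that(1)] fg[OF that(2)] by simp
  have img: "f ` X \<subseteq> carrier B" if "X \<subseteq> carrier A" for X
    using that fc by blast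
  have glb: "greatest A (g y) (Lower A X)"
    if X: "X \<subseteq> carrier A" and y: "greatest B y (Lower B (f ` X))" for X y
  proof -
    have yc: "y \<in> carrier B" using y by (simp add: greatest_def Lower_def)
    have low: "z \<in> Lower A X \<longleftrightarrow> f z \<in> Lower B (f ` X)" if "z \<in> carrier A" for z
      using that X fc by (auto simp: Lower_def subset_eq emb)
    show ?thesis
      unfolding greatest_def
    proof (intro conjI ballI)
      show "Lower A X \<subseteq> carrier A" by (simp add: Lower_def)
      show "g y \<in> Lower A X"
        using low[OF gc[OF yc]] fg[OF yc] y by (simp add: greatest_def)
      fix z assume z: "z \<in> Lower A X"
      then have zc: "z \<in> carrier A" by (simp add: Lower_def)
      have "f z \<sqsubseteq>\<^bsub>B\<^esub> y"
        using low[OF zc] z y by (simp add: greatest_def)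
      then show "z \<sqsubseteq>\<^bsub>A\<^esub> g y"
        using emb1[OF zc yc] by simp
    qed
  qed
  have lub: "least A (g y) (Upper A X)"
    if X: "X \<subseteq> carrier A" and y: "least B y (Upper B (f ` X))" for X y
  proof -
    have yc: "y \<in> carrier B" using y by (simp add: least_def Upper_def)
    have up: "z \<in> Upper A X \<longleftrightarrow> f z \<in> Upper B (f ` X)" if "z \<in> carrier A" for z
      using that X fc by (auto simp: Upper_def subset_eq emb)
    show ?thesis
      unfolding least_def
    proof (intro conjI ballI)
      show "Upper A X \<subseteq> carrier A" by (simp add: Upper_def)
      show "g y \<in> Upper A X"
        using up[OF gc[OF yc]] fg[OF yc] y by (simp add: least_def)
      fix z assume z: "z \<in> Upper A X"
      then have zc: "z \<in> carrier A" by (simp add: Upper_def)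
      have "y \<sqsubseteq>\<^bsub>B\<^esub> f z"
        using up[OF zc] z y by (simp add: least_def)
      then show "g y \<sqsubseteq>\<^bsub>A\<^esub> z"
        using emb2[OF zc yc] by simp
    qed
  qed
  have cA: "complete_lattice A"
    using glb[OF _ complete_lattice_Inf_greatest[OF B.complete_lattice_axioms img]]
      lub[OF _ complete_lattice_Sup_least[OF B.complete_lattice_axioms img]]
    by (intro partial_order.complete_latticeI[OF A]) blast+
  interpret A: complete_lattice A by fact
  have Infg: "\<Sqinter>\<^bsub>A\<^esub>X = g (\<Sqinter>\<^bsub>B\<^esub>(f ` X))" if "X \<subseteq> carrier A" for X
    using that glb complete_lattice_Inf_greatest[OF B.complete_lattice_axioms img]
    by (intro Inf_eqI[OF A]) blast
  have Supg: "\<Squnion>\<^bsub>A\<^esub>X = g (\<Squnion>\<^bsub>B\<^esub>(f ` X))" if "X \<subseteq> carrier A" for X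
    using that lub complete_lattice_Sup_least[OF B.complete_lattice_axioms img]
    by (intro Sup_eqI[OF A]) blast
  have fInf: "f (\<Sqinter>\<^bsub>A\<^esub>X) = \<Sqinter>\<^bsub>B\<^esub>(f ` X)" if "X \<subseteq> carrier A" for X
    using Infg[OF that] img[OF that] fg by (simp add: B.weak.inf_closed)
  have fSup: "f (\<Squnion>\<^bsub>A\<^esub>X) = \<Squnion>\<^bsub>B\<^esub>(f ` X)" if "X \<subseteq> carrier A" for X
    using Supg[OF that] img[OF that] fg by (simp add: B.weak.sup_closed)
  have fjoin: "f (x \<squnion>\<^bsub>A\<^esub> y) = f x \<squnion>\<^bsub>B\<^esub> f y" if "x \<in> carrier A" "y \<in> carrier A" for x y
    using fSup[of "{x, y}"] that by (simp add: join_def)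
  have fbot: "f \<bottom>\<^bsub>A\<^esub> = \<bottom>\<^bsub>B\<^esub>"
  proof -
    have "\<bottom>\<^bsub>A\<^esub> = g \<bottom>\<^bsub>B\<^esub>"
      using emb2[OF _ B.bottom_closed] B.bottom_lower fc gc
      by (intro bottom_eqI[OF A]) (auto simp: least_def)
    then show ?thesis by (simp add: fg)
  qed
  have inj: "x = y" if "x \<in> carrier A" "y \<in> carrier A" "f x = f y" for x y
    using that gf by metis
  have coA: "coframe A"
  proof
    fix x X assume x: "x \<in> carrier A" and X: "X \<subseteq> carrier A"
    have sub: "(\<lambda>a. x \<squnion>\<^bsub>A\<^esub> a) ` X \<subseteq> carrier A"
      using x X A.join_closed by blast
    have "f (x \<squnion>\<^bsub>A\<^esub> \<Sqinter>\<^bsub>A\<^esub>X) = f x \<squnion>\<^bsub>B\<^esub> \<Sqinter>\<^bsub>B\<^esub>(f ` X)"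
      using x X by (simp add: fjoin fInf)
    also have "\<dots> = \<Sqinter>\<^bsub>B\<^esub>((\<lambda>b. f x \<squnion>\<^bsub>B\<^esub> b) ` f ` X)"
      by (rule B.join_inf_distrib[OF fc[OF x] img[OF X]])
    also have "(\<lambda>b. f x \<squnion>\<^bsub>B\<^esub> b) ` f ` X = f ` (\<lambda>a. x \<squnion>\<^bsub>A\<^esub> a) ` X"
      unfolding image_image using x X by (intro image_cong) (auto simp: fjoin)
    also have "\<Sqinter>\<^bsub>B\<^esub>\<dots> = f (\<Sqinter>\<^bsub>A\<^esub>((\<lambda>a. x \<squnion>\<^bsub>A\<^esub> a) ` X))"
      by (rule fInf[OF sub, symmetric])
    finally show "x \<squnion>\<^bsub>A\<^esub> \<Sqinter>\<^bsub>A\<^esub>X = \<Sqinter>\<^bsub>A\<^esub>((\<lambda>a. x \<squnion>\<^bsub>A\<^esub> a) ` X)"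
      using x X sub by (intro inj) auto
  qed
  have gInf: "g (\<Sqinter>\<^bsub>B\<^esub>Y) = \<Sqinter>\<^bsub>A\<^esub>(g ` Y)" if Y: "Y \<subseteq> carrier B" for Y
  proof -
    have "f ` g ` Y = Y"
      using Y fg by (auto simp: image_image subset_iff intro: rev_image_eqI)
    moreover have "g ` Y \<subseteq> carrier A"
      using Y gc by blast
    ultimately show ?thesis
      using Infg[of "g ` Y"] by simp
  qed
  have gjoin: "g (x \<squnion>\<^bsub>B\<^esub> y) = g x \<squnion>\<^bsub>A\<^esub> g y" if "x \<in> carrier B" "y \<in> carrier B" for x y
    using that fjoin[of "g x" "g y"] gc gf fg A.join_closed by metis
  have gbot: "g \<bottom>\<^bsub>B\<^esub> = \<bottom>\<^bsub>A\<^esub>"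
    using fbot gf A.bottom_closed by metis
  have "coframe_hom A B f"
    unfolding coframe_hom_def using coA B f fInf fjoin fbot by simp
  moreover have "coframe_hom B A g"
    unfolding coframe_hom_def using coA B g gInf gjoin gbot by simp
  ultimately show ?thesis
    unfolding coframe_iso_def using gf fg by (intro conjI exI[of _ g] ballI)
qed

lemma partial_order_inclusion_order: "partial_order (inclusion_order \<A>)"
  by standard (auto simp: inclusion_order_def)

text \<open>
  In such a family meets are intersections and binary joins are unions, so the law is the
  distributivity of sets. Infinite joins exist but need not be unions. The set \<open>U\<close> serves as the
  empty intersection and is therefore the top; the least element is \<open>U \<inter> \<Inter>\<A>\<close>, which need not
  be empty.
\<close>

lemma coframe_inclusion_order:
  assumes sub: "\<And>S. S \<in> \<A> \<Longrightarrow> S \<subseteq> U"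
    and Int: "\<And>\<X>. \<X> \<subseteq> \<A> \<Longrightarrow> U \<inter> \<Inter>\<X> \<in> \<A>"
    and Un: "\<And>S T. \<lbrakk>S \<in> \<A>; T \<in> \<A>\<rbrakk> \<Longrightarrow> S \<union> T \<in> \<A>"
  shows "coframe (inclusion_order \<A>)"
proof -
  let ?L = "inclusion_order \<A>"
  have carr: "carrier ?L = \<A>" and le: "S \<sqsubseteq>\<^bsub>?L\<^esub> T \<longleftrightarrow> S \<subseteq> T" for S T
    by (simp_all add: inclusion_order_def)
  interpret partial_order ?L by (rule partial_order_inclusion_order)
  have glb: "greatest ?L (U \<inter> \<Inter>\<X>) (Lower ?L \<X>)" if "\<X> \<subseteq> \<A>" for \<X>
    using Int[OF that] that sub unfolding greatest_def Lower_def carr le by blast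
  have "complete_lattice ?L"
  proof (rule complete_lattice_criterion1)
    show "\<exists>G. greatest ?L G (carrier ?L)"
      using glb[of "{}"] by auto
    show "\<exists>I. greatest ?L I (Lower ?L \<X>)" if "\<X> \<subseteq> carrier ?L" for \<X>
      using glb that unfolding carr by blast
  qed
  then interpret complete_lattice ?L .
  have Inf: "\<Sqinter>\<^bsub>?L\<^esub>\<X> = U \<inter> \<Inter>\<X>" if "\<X> \<subseteq> \<A>" for \<X>
    using glb[OF that] by (intro Inf_eqI partial_order_axioms)
  have join: "S \<squnion>\<^bsub>?L\<^esub> T = S \<union> T" if "S \<in> \<A>" "T \<in> \<A>" for S T
    unfolding join_def
    using that Un[OF that]
    by (intro Sup_eqI partial_order_axioms) (auto simp: least_def Upper_def carr le)
  show ?thesis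
  proof
    fix S \<X> assume S: "S \<in> carrier ?L" and X: "\<X> \<subseteq> carrier ?L"
    have img: "(\<lambda>T. S \<squnion>\<^bsub>?L\<^esub> T) ` \<X> = (\<lambda>T. S \<union> T) ` \<X>"
      using S X by (intro image_cong) (auto simp: carr join)
    have "(\<lambda>T. S \<union> T) ` \<X> \<subseteq> \<A>"
      using S X Un by (auto simp: carr)
    then show "S \<squnion>\<^bsub>?L\<^esub> \<Sqinter>\<^bsub>?L\<^esub>\<X> = \<Sqinter>\<^bsub>?L\<^esub>((\<lambda>T. S \<squnion>\<^bsub>?L\<^esub> T) ` \<X>)"
      unfolding img using S X Int[of \<X>] sub[of S] by (auto simp: carr Inf join)
  qed
qed

section \<open>Sublocales and their primes\<close>

context frame
begin

lemma pt_closed: "p \<in> pt L \<Longrightarrow> p \<in> carrier L"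
  by (simp add: pt_def)

lemma le_Inf_iff:
  assumes "A \<subseteq> carrier L" "x \<in> carrier L"
  shows "x \<sqsubseteq> \<Sqinter>A \<longleftrightarrow> (\<forall>a\<in>A. x \<sqsubseteq> a)"
proof
  assume x: "x \<sqsubseteq> \<Sqinter>A"
  show "\<forall>a\<in>A. x \<sqsubseteq> a"
  proof
    fix a assume "a \<in> A"
    then show "x \<sqsubseteq> a"
      using le_trans[OF x weak.inf_lower[OF assms(1)]] assms by auto
  qed
next
  show "\<forall>a\<in>A. x \<sqsubseteq> a \<Longrightarrow> x \<sqsubseteq> \<Sqinter>A"
    using assms by (intro weak.inf_greatest) simp_all
qed

lemma le_meet_iff:
  assumes "x \<in> carrier L" "y \<in> carrier L" "z \<in> carrier L"
  shows "z \<sqsubseteq> x \<sqinter> y \<longleftrightarrow> z \<sqsubseteq> x \<and> z \<sqsubseteq> y"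
  unfolding meet_def using assms by (subst le_Inf_iff) auto

lemma meet_commute:
  assumes "x \<in> carrier L" "y \<in> carrier L"
  shows "x \<sqinter> y = y \<sqinter> x"
  by (simp add: meet_def insert_commute)

lemma Inf_empty_eq_top: "\<Sqinter>{} = \<top>"
  using le_antisym[OF top_higher _ _ top_closed] le_Inf_iff[of "{}" \<top>] by auto

lemma pt_not_top_le:
  assumes "p \<in> pt L"
  shows "\<not> \<top> \<sqsubseteq> p"
  using assms le_antisym[of p \<top>] by (auto simp: pt_def)

lemma meet_le_pt_iff:
  assumes "p \<in> pt L" "x \<in> carrier L" "y \<in> carrier L"
  shows "x \<sqinter> y \<sqsubseteq> p \<longleftrightarrow> x \<sqsubseteq> p \<or> y \<sqsubseteq> p"
proof
  show "x \<sqinter> y \<sqsubseteq> p \<Longrightarrow> x \<sqsubseteq> p \<or> y \<sqsubseteq> p"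
    using assms by (auto simp: pt_def)
  show "x \<sqsubseteq> p \<or> y \<sqsubseteq> p \<Longrightarrow> x \<sqinter> y \<sqsubseteq> p"
    using assms pt_closed[OF assms(1)] meet_left[of x y] meet_right[of x y]
      le_trans[of "x \<sqinter> y" x p] le_trans[of "x \<sqinter> y" y p] by auto
qed

lemma Inf_Un:
  assumes "A \<subseteq> carrier L" "B \<subseteq> carrier L"
  shows "\<Sqinter>(A \<union> B) = \<Sqinter>A \<sqinter> \<Sqinter>B"
proof (rule le_antisym)
  show c: "\<Sqinter>(A \<union> B) \<in> carrier L" "\<Sqinter>A \<sqinter> \<Sqinter>B \<in> carrier L"
    using assms by auto
  show "\<Sqinter>(A \<union> B) \<sqsubseteq> \<Sqinter>A \<sqinter> \<Sqinter>B"
    using assms c le_Inf_iff[of "A \<union> B" "\<Sqinter>(A \<union> B)"] by (simp add: le_meet_iff le_Inf_iff)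
  show "\<Sqinter>A \<sqinter> \<Sqinter>B \<sqsubseteq> \<Sqinter>(A \<union> B)"
    using assms c le_meet_iff[of "\<Sqinter>A" "\<Sqinter>B" "\<Sqinter>A \<sqinter> \<Sqinter>B"]
    by (simp add: le_Inf_iff ball_Un)
qed

lemma himp_closed: "himp L x y \<in> carrier L"
  unfolding himp_def by (rule weak.sup_closed) auto

lemma le_himp_iff:
  assumes x: "x \<in> carrier L" and y: "y \<in> carrier L" and z: "z \<in> carrier L"
  shows "z \<sqsubseteq> himp L x y \<longleftrightarrow> z \<sqinter> x \<sqsubseteq> y"
proof
  let ?Z = "{z \<in> carrier L. z \<sqinter> x \<sqsubseteq> y}"
  have h: "himp L x y \<in> carrier L" by (rule himp_closed)
  show "z \<sqinter> x \<sqsubseteq> y \<Longrightarrow> z \<sqsubseteq> himp L x y"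
    unfolding himp_def using z by (intro weak.sup_upper) auto
  assume z_le: "z \<sqsubseteq> himp L x y"
  have "x \<sqinter> himp L x y = \<Squnion>((\<lambda>z. x \<sqinter> z) ` ?Z)"
    unfolding himp_def using x by (intro meet_sup_distrib) auto
  also have "\<dots> \<sqsubseteq> y"
    using x y meet_commute[OF x] by (intro weak.sup_least) auto
  finally have "x \<sqinter> himp L x y \<sqsubseteq> y" .
  moreover have "z \<sqinter> x \<sqsubseteq> x \<sqinter> himp L x y"
    using x z h z_le meet_left[OF z x] meet_right[OF z x] le_trans[OF meet_left[OF z x] z_le]
    by (simp add: le_meet_iff)
  ultimately show "z \<sqinter> x \<sqsubseteq> y"
    using le_trans[of "z \<sqinter> x" "x \<sqinter> himp L x y" y] x y z h by auto
qed

lemma himp_meet_le: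
  assumes "x \<in> carrier L" "y \<in> carrier L"
  shows "himp L x y \<sqinter> x \<sqsubseteq> y"
  using le_himp_iff[OF assms himp_closed[of x y]] le_refl[OF himp_closed[of x y]] by simp

text \<open>
  A meet taken in the larger order that lands in \<open>S\<close> is also the meet in \<open>S\<close>; this lets all
  computations in a sublocale be made in \<open>L\<close>.
\<close>

lemma sub_order_Inf:
  assumes "S \<subseteq> carrier L" "A \<subseteq> S" "\<Sqinter>A \<in> S"
  shows "\<Sqinter>\<^bsub>sub_order L S\<^esub>A = \<Sqinter>A"
proof (rule Inf_eqI)
  show "partial_order (sub_order L S)"
    using weak_partial_order_subset[OF weak_partial_order_axioms assms(1)] eq_is_equal
    by (simp add: partial_order_def partial_order_axioms_def)
  show "greatest (sub_order L S) (\<Sqinter>A) (Lower (sub_order L S) A)"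
    unfolding greatest_def
  proof (intro conjI ballI)
    have Ac: "A \<subseteq> carrier L" and low: "\<And>a. a \<in> A \<Longrightarrow> \<Sqinter>A \<sqsubseteq> a"
      using assms weak.inf_lower[of A] by auto
    show "Lower (sub_order L S) A \<subseteq> carrier (sub_order L S)"
      by (simp add: Lower_def)
    show "\<Sqinter>A \<in> Lower (sub_order L S) A"
      using low assms(3) by (simp add: Lower_def)
    fix x assume "x \<in> Lower (sub_order L S) A"
    then have "x \<in> S" "\<forall>a\<in>A. x \<sqsubseteq> a"
      using assms(2) by (auto simp: Lower_def)
    then show "x \<sqsubseteq>\<^bsub>sub_order L S\<^esub> \<Sqinter>A"
      using assms(1) le_Inf_iff[OF Ac] by auto
  qed
qed

lemma sublocale_top:
  assumes "is_sublocale L S"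
  shows "\<top> \<in> S" "\<top>\<^bsub>sub_order L S\<^esub> = \<top>"
proof -
  have S: "S \<subseteq> carrier L" using assms by (simp add: is_sublocale_def)
  show top: "\<top> \<in> S"
    using assms Inf_empty_eq_top by (force simp: is_sublocale_def)
  show "\<top>\<^bsub>sub_order L S\<^esub> = \<top>"
    unfolding top_def[of "sub_order L S"]
  proof (rule some_equality)
    show "greatest (sub_order L S) \<top> (carrier (sub_order L S))"
      using top S by (auto simp: greatest_def)
    show "x = \<top>" if "greatest (sub_order L S) x (carrier (sub_order L S))" for x
      using that top S by (intro le_antisym) (auto simp: greatest_def)
  qed
qed

lemma sublocale_meet:
  assumes "is_sublocale L S" "x \<in> S" "y \<in> S"
  shows "x \<sqinter>\<^bsub>sub_order L S\<^esub> y = x \<sqinter> y"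
  unfolding meet_def using assms by (intro sub_order_Inf) (auto simp: is_sublocale_def)

text \<open>
  That a prime \<open>p\<close> of \<open>S\<close> is prime in \<open>L\<close> uses the stability under implication. If
  \<open>x \<sqinter> y \<sqsubseteq> p\<close>, replace the two factors by the elements \<open>y \<rightarrow> p \<sqsupseteq> x\<close> and
  \<open>(y \<rightarrow> p) \<rightarrow> p \<sqsupseteq> y\<close> of \<open>S\<close>, whose meet still lies below \<open>p\<close>.
\<close>

lemma pt_sublocale:
  assumes S: "is_sublocale L S"
  shows "pt (sub_order L S) = pt L \<inter> S"
proof (intro equalityI subsetI)
  fix p assume "p \<in> pt L \<inter> S"
  then show "p \<in> pt (sub_order L S)"
    using S by (auto simp: pt_def sublocale_top[OF S] sublocale_meet[OF S] is_sublocale_def subset_eq)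
next
  fix p assume p: "p \<in> pt (sub_order L S)"
  have sub: "S \<subseteq> carrier L" and him: "\<And>x s. x \<in> carrier L \<Longrightarrow> s \<in> S \<Longrightarrow> himp L x s \<in> S"
    using S by (auto simp: is_sublocale_def)
  have pS: "p \<in> S" and ptop: "p \<noteq> \<top>"
    and prime: "\<And>x y. \<lbrakk>x \<in> S; y \<in> S; x \<sqinter> y \<sqsubseteq> p\<rbrakk> \<Longrightarrow> x \<sqsubseteq> p \<or> y \<sqsubseteq> p"
    using p sublocale_meet[OF S] by (auto simp: pt_def sublocale_top[OF S])
  have pc: "p \<in> carrier L" using pS sub by blast
  have "x \<sqsubseteq> p \<or> y \<sqsubseteq> p" if x: "x \<in> carrier L" and y: "y \<in> carrier L" and xy: "x \<sqinter> y \<sqsubseteq> p" for x y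
  proof -
    let ?a = "himp L y p" and ?b = "himp L (himp L y p) p"
    have "?b \<sqinter> ?a \<sqsubseteq> p"
      by (rule himp_meet_le[OF himp_closed pc])
    then have "?b \<sqsubseteq> p \<or> ?a \<sqsubseteq> p"
      using prime[of ?b ?a] him[OF y pS] him[OF himp_closed pS] by simp
    moreover have "x \<sqsubseteq> ?a"
      using le_himp_iff[OF y pc x] xy by simp
    moreover have "y \<sqsubseteq> ?b"
      using le_himp_iff[OF himp_closed pc y] himp_meet_le[OF y pc] meet_commute[OF y himp_closed]
      by simp
    ultimately show ?thesis
      using le_trans[OF _ _ x himp_closed pc] le_trans[OF _ _ y himp_closed pc] by metis
  qed
  then show "p \<in> pt L \<inter> S"
    using pS pc ptop by (auto simp: pt_def)
qed

section \<open>Spatial sublocales are the sets of meets of primes\<close>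

lemma subset_meets_of:
  assumes "Y \<subseteq> carrier L"
  shows "Y \<subseteq> meets_of L Y"
proof
  fix y assume y: "y \<in> Y"
  then have yc: "y \<in> carrier L" using assms by blast
  have "\<Sqinter>{y} = y"
    using le_Inf_iff[of "{y}" "\<Sqinter>{y}"] le_Inf_iff[of "{y}" y] yc by (intro le_antisym) auto
  then show "y \<in> meets_of L Y"
    unfolding meets_of_def using y by (intro CollectI exI[of _ "{y}"]) auto
qed

lemma meets_of_mono: "Y \<subseteq> Z \<Longrightarrow> meets_of L Y \<subseteq> meets_of L Z"
  by (auto simp: meets_of_def)

text \<open>
  Among all sets of elements of \<open>Y\<close> that have meet \<open>a\<close> there is a largest one. Having this
  canonical choice avoids picking representing sets when meets of meets are formed.
\<close>

lemma meets_of_eq_Inf: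
  assumes "Y \<subseteq> carrier L" "a \<in> meets_of L Y"
  shows "a = \<Sqinter>{y \<in> Y. a \<sqsubseteq> y}"
proof -
  obtain M where M: "M \<subseteq> Y" "a = \<Sqinter>M"
    using assms by (auto simp: meets_of_def)
  have a: "a \<in> carrier L"
    using M assms by auto
  have Y': "{y \<in> Y. a \<sqsubseteq> y} \<subseteq> carrier L" using assms by auto
  have "M \<subseteq> {y \<in> Y. a \<sqsubseteq> y}"
    using M assms weak.inf_lower[of M] by auto
  then show ?thesis
    using le_Inf_iff[OF Y' a] le_Inf_iff[OF Y', of "\<Sqinter>{y \<in> Y. a \<sqsubseteq> y}"]
      le_Inf_iff[of M "\<Sqinter>{y \<in> Y. a \<sqsubseteq> y}"] M assms a Y'
    by (intro le_antisym) auto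
qed

lemma Inf_in_meets_of:
  assumes Y: "Y \<subseteq> carrier L" and A: "A \<subseteq> meets_of L Y"
  shows "\<Sqinter>A \<in> meets_of L Y"
proof -
  let ?M = "\<Union>a\<in>A. {y \<in> Y. a \<sqsubseteq> y}"
  have Ac: "A \<subseteq> carrier L"
    using A Y by (force simp: meets_of_def)
  have Mc: "?M \<subseteq> carrier L" using Y by auto
  have "z \<sqsubseteq> a \<longleftrightarrow> (\<forall>y\<in>{y \<in> Y. a \<sqsubseteq> y}. z \<sqsubseteq> y)" if a: "a \<in> A" and z: "z \<in> carrier L" for a z
  proof -
    have "a = \<Sqinter>{y \<in> Y. a \<sqsubseteq> y}"
      using meets_of_eq_Inf[OF Y] a A by blast
    then have "z \<sqsubseteq> a \<longleftrightarrow> z \<sqsubseteq> \<Sqinter>{y \<in> Y. a \<sqsubseteq> y}" by simp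
    also have "\<dots> \<longleftrightarrow> (\<forall>y\<in>{y \<in> Y. a \<sqsubseteq> y}. z \<sqsubseteq> y)"
      using Y z by (intro le_Inf_iff) auto
    finally show ?thesis .
  qed
  then have *: "z \<sqsubseteq> \<Sqinter>A \<longleftrightarrow> z \<sqsubseteq> \<Sqinter>?M" if "z \<in> carrier L" for z
    using that by (simp add: le_Inf_iff[OF Ac] le_Inf_iff[OF Mc])
  have "\<Sqinter>A = \<Sqinter>?M"
    using *[of "\<Sqinter>A"] *[of "\<Sqinter>?M"] Ac Mc by (intro le_antisym) auto
  then show ?thesis
    unfolding meets_of_def by (intro CollectI exI[of _ ?M]) auto
qed

text \<open>
  For a prime \<open>p\<close>, the condition \<open>z \<sqinter> x \<sqsubseteq> p\<close> is vacuous if \<open>x \<sqsubseteq> p\<close> and amounts to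
  \<open>z \<sqsubseteq> p\<close> otherwise. So the primes above \<open>x\<close> drop out of the meet and the others stay. This
  is why sets of meets of primes are stable under implication.
\<close>

lemma himp_Inf_pt:
  assumes M: "M \<subseteq> pt L" and x: "x \<in> carrier L"
  shows "himp L x (\<Sqinter>M) = \<Sqinter>{p \<in> M. \<not> x \<sqsubseteq> p}"
proof -
  let ?N = "{p \<in> M. \<not> x \<sqsubseteq> p}"
  have Mc: "M \<subseteq> carrier L" and Nc: "?N \<subseteq> carrier L"
    using M pt_closed by auto
  have *: "z \<sqsubseteq> himp L x (\<Sqinter>M) \<longleftrightarrow> z \<sqsubseteq> \<Sqinter>?N" if z: "z \<in> carrier L" for z
  proof -
    have "z \<sqsubseteq> himp L x (\<Sqinter>M) \<longleftrightarrow> (\<forall>p\<in>M. z \<sqinter> x \<sqsubseteq> p)"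
      using x z Mc by (simp add: le_himp_iff le_Inf_iff)
    also have "\<dots> \<longleftrightarrow> (\<forall>p\<in>M. z \<sqsubseteq> p \<or> x \<sqsubseteq> p)"
      using M x z meet_le_pt_iff by (intro ball_cong) auto
    also have "\<dots> \<longleftrightarrow> z \<sqsubseteq> \<Sqinter>?N"
      using z by (auto simp: le_Inf_iff[OF Nc])
    finally show ?thesis .
  qed
  show ?thesis
    using *[of "himp L x (\<Sqinter>M)"] *[of "\<Sqinter>?N"] himp_closed Nc by (intro le_antisym) auto
qed

lemma is_sublocale_meets_of:
  assumes Y: "Y \<subseteq> pt L"
  shows "is_sublocale L (meets_of L Y)"
proof -
  have Yc: "Y \<subseteq> carrier L" using Y pt_closed by blast
  have "himp L x s \<in> meets_of L Y" if x: "x \<in> carrier L" and s: "s \<in> meets_of L Y" for x s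
  proof -
    obtain M where M: "M \<subseteq> Y" "s = \<Sqinter>M"
      using s by (auto simp: meets_of_def)
    show ?thesis
      unfolding meets_of_def using himp_Inf_pt[of M x] M Y x
      by (intro CollectI exI[of _ "{p \<in> M. \<not> x \<sqsubseteq> p}"]) auto
  qed
  moreover have "meets_of L Y \<subseteq> carrier L"
    using Yc by (force simp: meets_of_def)
  ultimately show ?thesis
    using Inf_in_meets_of[OF Yc] by (simp add: is_sublocale_def)
qed

lemma spatial_sublocale_iff:
  assumes S: "is_sublocale L S"
  shows "spatial (sub_order L S) \<longleftrightarrow> S = meets_of L (pt L \<inter> S)"
proof -
  have *: "\<Sqinter>\<^bsub>sub_order L S\<^esub>P = \<Sqinter>P" "\<Sqinter>P \<in> S" if "P \<subseteq> pt L \<inter> S" for P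
    using that S by (auto simp: is_sublocale_def intro!: sub_order_Inf)
  have "meets_of L (pt L \<inter> S) \<subseteq> S"
    using * by (auto simp: meets_of_def)
  moreover have "(\<exists>P\<subseteq>pt L \<inter> S. a = \<Sqinter>\<^bsub>sub_order L S\<^esub>P) \<longleftrightarrow> a \<in> meets_of L (pt L \<inter> S)" for a
    unfolding meets_of_def mem_Collect_eq using *(1) by metis
  then have "spatial (sub_order L S) \<longleftrightarrow> S \<subseteq> meets_of L (pt L \<inter> S)"
    by (simp add: spatial_def pt_sublocale[OF S] subset_eq)
  ultimately show ?thesis by blast
qed

lemma spatial_meets_of:
  assumes Y: "Y \<subseteq> pt L"
  shows "spatial (sub_order L (meets_of L Y))"
proof -
  let ?S = "meets_of L Y"
  have S: "is_sublocale L ?S" by (rule is_sublocale_meets_of[OF Y])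
  have "Y \<subseteq> pt L \<inter> ?S"
    using Y subset_meets_of[of Y] pt_closed by blast
  then have "?S \<subseteq> meets_of L (pt L \<inter> ?S)"
    by (rule meets_of_mono)
  moreover have "meets_of L (pt L \<inter> ?S) \<subseteq> ?S"
    using S by (auto simp: meets_of_def[of L "pt L \<inter> ?S"] is_sublocale_def)
  ultimately show ?thesis
    using spatial_sublocale_iff[OF S] by blast
qed

section \<open>Sober subspaces are the sets of primes closed under prime meets\<close>

lemma closedin_pt_subspace:
  assumes Y: "Y \<subseteq> pt L"
  shows "closedin (subtopology (pt_space L) Y) C \<longleftrightarrow> (\<exists>a \<in> carrier L. C = {q \<in> Y. a \<sqsubseteq> q})"
proof -
  have compl: "D = {q \<in> pt L. a \<sqsubseteq> q} \<longleftrightarrow> D \<subseteq> pt L \<and> pt L - D = {q \<in> pt L. \<not> a \<sqsubseteq> q}" for D a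
    by blast
  have closed: "closedin (pt_space L) D \<longleftrightarrow> (\<exists>a \<in> carrier L. D = {q \<in> pt L. a \<sqsubseteq> q})" for D
    unfolding closedin_def openin_pt_space[OF frame_axioms] topspace_pt_space[OF frame_axioms] compl
    by blast
  have trace: "{q \<in> pt L. a \<sqsubseteq> q} \<inter> Y = {q \<in> Y. a \<sqsubseteq> q}" for a
    using Y by blast
  have "closedin (subtopology (pt_space L) Y) C \<longleftrightarrow>
      (\<exists>a \<in> carrier L. C = {q \<in> pt L. a \<sqsubseteq> q} \<inter> Y)"
    unfolding closedin_subtopology closed by blast
  then show ?thesis
    unfolding trace .
qed

lemma topspace_pt_subspace:
  assumes "Y \<subseteq> pt L"
  shows "topspace (subtopology (pt_space L) Y) = Y"
  using assms by (simp add: topspace_pt_space[OF frame_axioms] Int_absorb1)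

lemma closure_of_pt_subspace:
  assumes Y: "Y \<subseteq> pt L" and y: "y \<in> Y"
  shows "subtopology (pt_space L) Y closure_of {y} = {q \<in> Y. y \<sqsubseteq> q}"
proof (rule closure_of_unique)
  have yc: "y \<in> carrier L" using Y y pt_closed by blast
  show "{y} \<subseteq> {q \<in> Y. y \<sqsubseteq> q}"
    using y yc by auto
  show "closedin (subtopology (pt_space L) Y) {q \<in> Y. y \<sqsubseteq> q}"
    using yc closedin_pt_subspace[OF Y] by blast
  show "{q \<in> Y. y \<sqsubseteq> q} \<subseteq> T" if T: "{y} \<subseteq> T" "closedin (subtopology (pt_space L) Y) T" for T
  proof -
    obtain a where a: "a \<in> carrier L" "T = {q \<in> Y. a \<sqsubseteq> q}"
      using T(2) unfolding closedin_pt_subspace[OF Y] by (elim bexE)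
    then have "a \<sqsubseteq> y" using T(1) by simp
    then show ?thesis
      unfolding a(2) using Y by (auto intro: le_trans[OF _ _ a(1) yc pt_closed])
  qed
qed

text \<open>
  A closed set \<open>C\<close> of the subspace is recovered from its meet as the part of \<open>Y\<close> above it, so
  irreducibility can be tested on \<open>\<Sqinter>C\<close>, where it becomes primeness: covering \<open>C\<close> by the closed
  sets of \<open>x\<close> and \<open>y\<close> means \<open>x \<sqinter> y \<sqsubseteq> \<Sqinter>C\<close>, and nonemptiness of \<open>C\<close> corresponds to
  \<open>\<Sqinter>C \<noteq> \<top>\<close>. The prime \<open>\<Sqinter>C\<close> need not belong to \<open>Y\<close>.
\<close>

lemma irreducible_closed_pt_subspace:
  assumes Y: "Y \<subseteq> pt L"
  shows "irreducible_closed (subtopology (pt_space L) Y) C \<longleftrightarrow>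
    (\<exists>p \<in> pt L \<inter> meets_of L Y. C = {q \<in> Y. p \<sqsubseteq> q})"
    (is "irreducible_closed ?X C \<longleftrightarrow> _")
proof
  have Yc: "Y \<subseteq> carrier L" using Y pt_closed by blast
  {
    assume C: "irreducible_closed ?X C"
    then obtain a where a: "a \<in> carrier L" "C = {q \<in> Y. a \<sqsubseteq> q}"
      unfolding irreducible_closed_def closedin_pt_subspace[OF Y] by (elim conjE bexE)
    let ?p = "\<Sqinter>C"
    have Cc: "C \<subseteq> carrier L" using a(2) Yc by blast
    have pc: "?p \<in> carrier L" by (rule weak.inf_closed[OF Cc])
    have lower: "?p \<sqsubseteq> q" if "q \<in> C" for q
      using weak.inf_lower[OF Cc] that by auto
    have "a \<sqsubseteq> ?p"
      using a(2) le_Inf_iff[OF Cc a(1)] by blast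
    then have "a \<sqsubseteq> q" if "q \<in> Y" "?p \<sqsubseteq> q" for q
      using that le_trans[OF _ _ a(1) pc, of q] Yc by blast
    then have C_eq: "C = {q \<in> Y. ?p \<sqsubseteq> q}"
      using a(2) lower by blast
    obtain q where q: "q \<in> C" using C by (auto simp: irreducible_closed_def)
    then have "?p \<noteq> \<top>"
      using lower[OF q] pt_not_top_le[of q] a Y by auto
    moreover have "x \<sqsubseteq> ?p \<or> y \<sqsubseteq> ?p"
      if x: "x \<in> carrier L" and y: "y \<in> carrier L" and xy: "x \<sqinter> y \<sqsubseteq> ?p" for x y
    proof -
      \<comment> \<open>Joining with \<open>a\<close> cuts the closed sets of \<open>x\<close> and \<open>y\<close> down to \<open>C\<close>, as
        irreducibility speaks of closed sets whose union is \<open>C\<close>.\<close>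
      let ?A = "{q \<in> Y. a \<squnion> x \<sqsubseteq> q}" and ?B = "{q \<in> Y. a \<squnion> y \<sqsubseteq> q}"
      have split: "x \<sqsubseteq> q \<or> y \<sqsubseteq> q" if "q \<in> C" for q
      proof -
        have q: "q \<in> pt L" using that a(2) Y by blast
        have "x \<sqinter> y \<sqsubseteq> q"
          by (rule le_trans[OF xy lower[OF that] meet_closed[OF x y] pc pt_closed[OF q]])
        then show ?thesis
          using meet_le_pt_iff[OF q x y] by simp
      qed
      have join: "a \<squnion> z \<sqsubseteq> q \<longleftrightarrow> a \<sqsubseteq> q \<and> z \<sqsubseteq> q" if "z \<in> carrier L" "q \<in> Y" for z q
      proof -
        have q: "q \<in> carrier L" using that Yc by blast
        show ?thesis
          using a(1) that(1) q join_left[OF a(1) that(1)] join_right[OF a(1) that(1)]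
            le_trans[OF _ _ a(1) _ q, of "a \<squnion> z"] le_trans[OF _ _ that(1) _ q, of "a \<squnion> z"]
            join_le[of a q z] join_closed by metis
      qed
      have "closedin ?X ?A" "closedin ?X ?B"
        unfolding closedin_pt_subspace[OF Y] using a(1) x y by (auto intro: join_closed)
      moreover have "C = ?A \<union> ?B"
        using split a(2) join[OF x] join[OF y] by blast
      ultimately have "C = ?A \<or> C = ?B"
        using C unfolding irreducible_closed_def by blast
      moreover have "\<forall>q\<in>?A. x \<sqsubseteq> q" "\<forall>q\<in>?B. y \<sqsubseteq> q"
        using join[OF x] join[OF y] by blast+
      ultimately have "(\<forall>q\<in>C. x \<sqsubseteq> q) \<or> (\<forall>q\<in>C. y \<sqsubseteq> q)"
        by metis
      then show ?thesis
        using x y by (simp add: le_Inf_iff[OF Cc])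
    qed
    ultimately have "?p \<in> pt L"
      using pc by (auto simp: pt_def)
    moreover have "?p \<in> meets_of L Y"
      unfolding meets_of_def using a by auto
    ultimately show "\<exists>p \<in> pt L \<inter> meets_of L Y. C = {q \<in> Y. p \<sqsubseteq> q}"
      using C_eq by blast
  }
  assume "\<exists>p \<in> pt L \<inter> meets_of L Y. C = {q \<in> Y. p \<sqsubseteq> q}"
  then obtain p where p: "p \<in> pt L" "p \<in> meets_of L Y" and C: "C = {q \<in> Y. p \<sqsubseteq> q}"
    by blast
  have pc: "p \<in> carrier L" using p(1) pt_closed by blast
  have pInf: "p = \<Sqinter>C"
    using meets_of_eq_Inf[OF Yc p(2)] C by simp
  \<comment> \<open>The empty meet is the top, which is not prime.\<close>
  have "C \<noteq> {}"
    using pInf p(1) Inf_empty_eq_top by (auto simp: pt_def)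
  moreover have "closedin ?X C"
    unfolding closedin_pt_subspace[OF Y] using pc C by (rule bexI[rotated])
  moreover have "C = A \<or> C = B" if A: "closedin ?X A" and B: "closedin ?X B" and AB: "C = A \<union> B" for A B
  proof -
    obtain a b where a: "a \<in> carrier L" "A = {q \<in> Y. a \<sqsubseteq> q}" and b: "b \<in> carrier L" "B = {q \<in> Y. b \<sqsubseteq> q}"
      using A B unfolding closedin_pt_subspace[OF Y] by (elim bexE)
    have Cc: "C \<subseteq> carrier L" using C Yc by auto
    have "a \<sqinter> b \<sqsubseteq> q" if "q \<in> C" for q
      using that AB a b Y meet_le_pt_iff[of q a b] by auto
    then have "a \<sqinter> b \<sqsubseteq> p"
      unfolding pInf using a b le_Inf_iff[OF Cc] by simp
    then have "a \<sqsubseteq> p \<or> b \<sqsubseteq> p"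
      using meet_le_pt_iff[OF p(1) a(1) b(1)] by blast
    then have "C \<subseteq> A \<or> C \<subseteq> B"
      unfolding C a(2) b(2) using le_trans[OF _ _ a(1) pc] le_trans[OF _ _ b(1) pc] Yc by auto
    then show ?thesis using AB by blast
  qed
  ultimately show "irreducible_closed ?X C"
    by (auto simp: irreducible_closed_def)
qed

text \<open>
  An irreducible closed set corresponds to a prime \<open>p\<close> that is a meet of elements of \<open>Y\<close>, and
  it is the closure of \<open>y\<close> exactly if \<open>y = p\<close>. Generic points therefore exist if and only if all
  such primes lie in \<open>Y\<close>; their uniqueness is the antisymmetry of the order.
\<close>

lemma sober_pt_subspace_iff:
  assumes Y: "Y \<subseteq> pt L"
  shows "sober_space (subtopology (pt_space L) Y) \<longleftrightarrow> pt L \<inter> meets_of L Y = Y"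
    (is "sober_space ?X \<longleftrightarrow> _")
proof
  have Yc: "Y \<subseteq> carrier L" using Y pt_closed by blast
  have YM: "Y \<subseteq> meets_of L Y" by (rule subset_meets_of[OF Yc])
  {
    assume sober: "sober_space ?X"
    have "p \<in> Y" if p: "p \<in> pt L" "p \<in> meets_of L Y" for p
    proof -
      let ?C = "{q \<in> Y. p \<sqsubseteq> q}"
      have pc: "p \<in> carrier L" using p(1) pt_closed by blast
      have "irreducible_closed ?X ?C"
        using irreducible_closed_pt_subspace[OF Y] p by blast
      then obtain y where y: "y \<in> Y" "?C = ?X closure_of {y}"
        using sober topspace_pt_subspace[OF Y] unfolding sober_space_def by metis
      have yc: "y \<in> carrier L" using y Yc by blast
      have C_eq: "?C = {q \<in> Y. y \<sqsubseteq> q}"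
        unfolding y(2) by (rule closure_of_pt_subspace[OF Y y(1)])
      then have "p \<sqsubseteq> y"
        using y(1) yc by blast
      moreover have "y \<sqsubseteq> \<Sqinter>?C"
        using C_eq yc Yc by (subst le_Inf_iff) auto
      then have "y \<sqsubseteq> p"
        unfolding meets_of_eq_Inf[OF Yc p(2), symmetric] .
      ultimately have "p = y"
        using pc yc by (intro le_antisym)
      then show ?thesis using y(1) by simp
    qed
    then show "pt L \<inter> meets_of L Y = Y"
      using Y YM by blast
  }
  assume eq: "pt L \<inter> meets_of L Y = Y"
  show "sober_space ?X"
    unfolding sober_space_def
  proof (intro allI impI)
    fix C assume "irreducible_closed ?X C"
    then obtain p where p: "p \<in> Y" "C = {q \<in> Y. p \<sqsubseteq> q}"
      unfolding irreducible_closed_pt_subspace[OF Y] eq by (elim bexE)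
    show "\<exists>!x. x \<in> topspace ?X \<and> C = ?X closure_of {x}"
      unfolding topspace_pt_subspace[OF Y]
    proof (intro ex1I[of _ p] conjI)
      show "C = ?X closure_of {p}"
        using p closure_of_pt_subspace[OF Y] by simp
      fix x assume x: "x \<in> Y \<and> C = ?X closure_of {x}"
      then have eq: "{q \<in> Y. x \<sqsubseteq> q} = {q \<in> Y. p \<sqsubseteq> q}"
        using p closure_of_pt_subspace[OF Y] by simp
      have pc: "p \<in> carrier L" and xc: "x \<in> carrier L"
        using x p(1) Yc by auto
      have "x \<in> {q \<in> Y. x \<sqsubseteq> q}" "p \<in> {q \<in> Y. p \<sqsubseteq> q}"
        using x p(1) pc xc by simp_all
      then have "p \<sqsubseteq> x" "x \<sqsubseteq> p"
        using eq by blast+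
      then show "x = p"
        using pc xc by (intro le_antisym)
    qed (rule p(1))
  qed
qed

lemma carrier_sober_subspaces:
  "carrier (sober_subspaces L) = {Y. Y \<subseteq> pt L \<and> pt L \<inter> meets_of L Y = Y}"
proof -
  have "carrier (sober_subspaces L) = {Y. Y \<subseteq> pt L \<and> sober_space (subtopology (pt_space L) Y)}"
    by (simp add: sober_subspaces_def inclusion_order_def)
  also have "\<dots> = {Y. Y \<subseteq> pt L \<and> pt L \<inter> meets_of L Y = Y}"
    by (intro Collect_cong conj_cong sober_pt_subspace_iff) simp_all
  finally show ?thesis .
qed

text \<open>
  A meet over a subset of \<open>Y \<union> Z\<close> is the meet of a part from \<open>Y\<close> and a part from \<open>Z\<close>, and a
  prime that is a meet of two elements is one of them.
\<close>

lemma pt_meets_of_Un: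
  assumes "Y \<subseteq> pt L" "Z \<subseteq> pt L"
  shows "pt L \<inter> meets_of L (Y \<union> Z) = (pt L \<inter> meets_of L Y) \<union> (pt L \<inter> meets_of L Z)"
proof
  show "(pt L \<inter> meets_of L Y) \<union> (pt L \<inter> meets_of L Z) \<subseteq> pt L \<inter> meets_of L (Y \<union> Z)"
    using meets_of_mono[of Y "Y \<union> Z"] meets_of_mono[of Z "Y \<union> Z"] by blast
  show "pt L \<inter> meets_of L (Y \<union> Z) \<subseteq> (pt L \<inter> meets_of L Y) \<union> (pt L \<inter> meets_of L Z)"
  proof
    fix p assume p: "p \<in> pt L \<inter> meets_of L (Y \<union> Z)"
    then obtain M where M: "M \<subseteq> Y \<union> Z" "p = \<Sqinter>M"
      by (auto simp: meets_of_def)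
    let ?a = "\<Sqinter>(M \<inter> Y)" and ?b = "\<Sqinter>(M \<inter> Z)"
    have Mc: "M \<subseteq> carrier L" using M assms pt_closed by blast
    have pc: "p \<in> carrier L" using p pt_closed by blast
    have ac: "?a \<in> carrier L" and bc: "?b \<in> carrier L"
      using Mc by (auto intro!: weak.inf_closed)
    have "M = (M \<inter> Y) \<union> (M \<inter> Z)" using M by blast
    then have pab: "p = ?a \<sqinter> ?b"
      using Inf_Un[of "M \<inter> Y" "M \<inter> Z"] M Mc by auto
    then have "p \<sqsubseteq> ?a" "p \<sqsubseteq> ?b"
      using ac bc by (auto intro: meet_left meet_right)
    moreover have "?a \<sqsubseteq> p \<or> ?b \<sqsubseteq> p"
      using meet_le_pt_iff[of p ?a ?b] p pab ac bc pc by auto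
    ultimately have "p = ?a \<or> p = ?b"
      using le_antisym[OF _ _ pc ac] le_antisym[OF _ _ pc bc] by argo
    then show "p \<in> (pt L \<inter> meets_of L Y) \<union> (pt L \<inter> meets_of L Z)"
      using p by (auto simp: meets_of_def)
  qed
qed

lemma coframe_sober_subspaces: "coframe (sober_subspaces L)"
proof -
  let ?\<A> = "{Y. Y \<subseteq> pt L \<and> pt L \<inter> meets_of L Y = Y}"
  have "coframe (inclusion_order ?\<A>)"
  proof (rule coframe_inclusion_order)
    fix \<X> assume X: "\<X> \<subseteq> ?\<A>"
    let ?I = "pt L \<inter> \<Inter>\<X>"
    have "pt L \<inter> meets_of L ?I \<subseteq> Y" if "Y \<in> \<X>" for Y
      using that X meets_of_mono[of ?I Y] by blast
    moreover have "?I \<subseteq> meets_of L ?I"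
      using pt_closed by (intro subset_meets_of) blast
    ultimately show "?I \<in> ?\<A>" by blast
  qed (auto simp: pt_meets_of_Un)
  moreover have "sober_subspaces L = inclusion_order ?\<A>"
    using carrier_sober_subspaces by (simp add: sober_subspaces_def inclusion_order_def)
  ultimately show ?thesis by simp
qed

end

section \<open>The isomorphism\<close>

theorem proposition5p1:
  fixes L :: "('a, 'm) gorder_scheme"
  assumes "frame L"
  shows "(\<forall>S. is_sublocale L S \<longrightarrow> pt (sub_order L S) = pt L \<inter> S) \<and>
    coframe_iso (spatial_sublocales L) (sober_subspaces L) (\<lambda>S. pt (sub_order L S)) \<and>
    (\<forall>Y \<in> carrier (sober_subspaces L).
       inv_into (carrier (spatial_sublocales L)) (\<lambda>S. pt (sub_order L S)) Y = meets_of L Y)"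
proof -
  interpret frame L by fact
  let ?f = "\<lambda>S. pt (sub_order L S)"
  let ?A = "carrier (spatial_sublocales L)" and ?B = "carrier (sober_subspaces L)"
  have S: "is_sublocale L S" "?f S = pt L \<inter> S" "meets_of L (?f S) = S" if "S \<in> ?A" for S
    using that spatial_sublocale_iff[of S] pt_sublocale[of S]
    by (auto simp: spatial_sublocales_def inclusion_order_def)
  have fB: "?f S \<in> ?B" if "S \<in> ?A" for S
    using S[OF that] by (simp add: carrier_sober_subspaces)
  have gA: "meets_of L Y \<in> ?A" and fg: "?f (meets_of L Y) = Y" if "Y \<in> ?B" for Y
    using that is_sublocale_meets_of[of Y] spatial_meets_of[of Y] pt_sublocale[of "meets_of L Y"]
    by (auto simp: carrier_sober_subspaces spatial_sublocales_def inclusion_order_def)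
  have "coframe_iso (spatial_sublocales L) (sober_subspaces L) ?f"
  proof (rule coframe_iso_if_order_iso)
    show "partial_order (spatial_sublocales L)"
      unfolding spatial_sublocales_def by (rule partial_order_inclusion_order)
    show "?f S \<sqsubseteq>\<^bsub>sober_subspaces L\<^esub> ?f T \<longleftrightarrow> S \<sqsubseteq>\<^bsub>spatial_sublocales L\<^esub> T"
      if "S \<in> ?A" "T \<in> ?A" for S T
      using S[OF that(1)] S[OF that(2)] meets_of_mono[of "?f S" "?f T"]
      by (auto simp: spatial_sublocales_def sober_subspaces_def inclusion_order_def)
  qed (use coframe_sober_subspaces fB gA fg S(3) in auto)
  moreover have "inv_into ?A ?f Y = meets_of L Y" if "Y \<in> ?B" for Y
  proof (rule inv_into_f_eq)
    show "inj_on ?f ?A"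
      by (rule inj_on_inverseI) (rule S(3))
  qed (use that gA fg in auto)
  ultimately show ?thesis
    using pt_sublocale by blast
qed

end
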